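(* It is not true that for all positive semidefinite matrices $A,B$ (of equal size), all unitarily invariant norms $|||\cdot|||$, and all non-negative increasing convex functions $g:[0,\infty)\to\mathbb{R}$ with $g(0)=0$, the inequality $|||g(A)-g(B)|||\ge|||g(|A-B|)|||$ holds. That is, there exist $n\in\mathbb{N}$, $n\times n$ complex positive semidefinite matrices $A,B$, a unitarily invariant norm $|||\cdot|||$ on the $n\times n$ complex matrices, and a non-negative increasing convex function $g:[0,\infty)\to\mathbb{R}$ with $g(0)=0$ such that $|||g(A)-g(B)|||<|||g(|A-B|)|||$.
   Context: A norm on $n\times n$ complex matrices is unitarily invariant if $|||UXV|||=|||X|||$ for all matrices $X$ and all unitary $U,V$. For a matrix $X$, $|X|=(X^*X)^{1/2}$. For a positive semidefinite matrix $X$, $g(X)$ is defined by the spectral functional calculus. *)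

theory Defs
  imports
    "HOL-Analysis.Convex"
    "Jordan_Normal_Form.Schur_Decomposition"
begin

definition unitary_mat :: "nat \<Rightarrow> complex mat \<Rightarrow> bool" where
  "unitary_mat n U \<longleftrightarrow> U \<in> carrier_mat n n
     \<and> mat_adjoint U * U = 1\<^sub>m n \<and> U * mat_adjoint U = 1\<^sub>m n"

definition psd_mat :: "nat \<Rightarrow> complex mat \<Rightarrow> bool" where
  "psd_mat n A \<longleftrightarrow> A \<in> carrier_mat n n \<and> mat_adjoint A = A
     \<and> (\<forall>v \<in> carrier_vec n. 0 \<le> Re ((A *\<^sub>v v) \<bullet>c v))"

definition spectral_decomp :: "nat \<Rightarrow> complex mat \<Rightarrow> complex mat \<Rightarrow> (nat \<Rightarrow> real) \<Rightarrow> bool" where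
  "spectral_decomp n X U d \<longleftrightarrow> unitary_mat n U
     \<and> X = U * mat_diag n (\<lambda>i. complex_of_real (d i)) * mat_adjoint U"

text \<open>
  The value of the description below does not depend on the chosen decomposition, see
  \<open>fun_mat_eq\<close>. It is meaningful for Hermitian arguments only.
\<close>

definition fun_mat :: "(real \<Rightarrow> real) \<Rightarrow> complex mat \<Rightarrow> complex mat" where
  "fun_mat g X = (THE Y. \<exists>U d. spectral_decomp (dim_row X) X U d
     \<and> Y = U * mat_diag (dim_row X) (\<lambda>i. complex_of_real (g (d i))) * mat_adjoint U)"

definition abs_mat :: "complex mat \<Rightarrow> complex mat" where
  "abs_mat X = fun_mat sqrt (mat_adjoint X * X)"

definition mat_norm :: "nat \<Rightarrow> (complex mat \<Rightarrow> real) \<Rightarrow> bool" where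
  "mat_norm n N \<longleftrightarrow>
     (\<forall>X \<in> carrier_mat n n. 0 \<le> N X \<and> (N X = 0 \<longleftrightarrow> X = 0\<^sub>m n n))
   \<and> (\<forall>X \<in> carrier_mat n n. \<forall>c. N (c \<cdot>\<^sub>m X) = cmod c * N X)
   \<and> (\<forall>X \<in> carrier_mat n n. \<forall>Y \<in> carrier_mat n n. N (X + Y) \<le> N X + N Y)"

definition unitarily_invariant_norm :: "nat \<Rightarrow> (complex mat \<Rightarrow> real) \<Rightarrow> bool" where
  "unitarily_invariant_norm n N \<longleftrightarrow> mat_norm n N
   \<and> (\<forall>X \<in> carrier_mat n n. \<forall>U V. unitary_mat n U \<longrightarrow> unitary_mat n V
        \<longrightarrow> N (U * X * V) = N X)"

lemma mat_adjoint_carrier: "A \<in> carrier_mat n m \<Longrightarrow> mat_adjoint A \<in> carrier_mat m n"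
  by (auto simp: mat_adjoint_def)

lemma mat_diag_intertwine:
  fixes W :: "complex mat" and d e g :: "nat \<Rightarrow> real"
  assumes W: "W \<in> carrier_mat n n"
    and eq: "W * mat_diag n (\<lambda>i. complex_of_real (d i)) = mat_diag n (\<lambda>i. complex_of_real (e i)) * W"
  shows "W * mat_diag n (\<lambda>i. complex_of_real (h (d i))) = mat_diag n (\<lambda>i. complex_of_real (h (e i))) * W"
proof -
  have *: "W $$ (i,j) * complex_of_real (h (d j)) = complex_of_real (h (e i)) * W $$ (i,j)"
    if ij: "i < n" "j < n" for i j
  proof -
    have "(W * mat_diag n (\<lambda>i. complex_of_real (d i))) $$ (i,j)
        = (mat_diag n (\<lambda>i. complex_of_real (e i)) * W) $$ (i,j)"
      using eq by simp
    then have "W $$ (i,j) * complex_of_real (d j) = complex_of_real (e i) * W $$ (i,j)"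
      using ij by (simp add: mat_diag_mult_left[OF W] mat_diag_mult_right[OF W])
    then have "W $$ (i,j) = 0 \<or> d j = e i"
      by (simp add: mult.commute)
    then show ?thesis by auto
  qed
  show ?thesis
    unfolding mat_diag_mult_left[OF W] mat_diag_mult_right[OF W]
    by (rule eq_matI) (auto simp: *)
qed

lemma fun_mat_eq:
  assumes X: "X \<in> carrier_mat n n" and dec: "spectral_decomp n X U d"
  shows "fun_mat g X = U * mat_diag n (\<lambda>i. complex_of_real (g (d i))) * mat_adjoint U"
proof -
  have n: "dim_row X = n" using X by simp
  let ?D = "\<lambda>d. mat_diag n (\<lambda>i. complex_of_real (d i))"
  have uniq: "V * ?D (\<lambda>i. g (e i)) * mat_adjoint V = U * ?D (\<lambda>i. g (d i)) * mat_adjoint U"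
    if dec': "spectral_decomp n X V e" for V e
  proof -
    note defs = spectral_decomp_def unitary_mat_def
    let ?U' = "mat_adjoint U" and ?V' = "mat_adjoint V"
    have U: "U \<in> carrier_mat n n" and UU: "?U' * U = 1\<^sub>m n" "U * ?U' = 1\<^sub>m n"
      and XU: "X = U * ?D d * ?U'" using dec by (auto simp: defs)
    have V: "V \<in> carrier_mat n n" and VV: "?V' * V = 1\<^sub>m n" "V * ?V' = 1\<^sub>m n"
      and XV: "X = V * ?D e * ?V'" using dec' by (auto simp: defs)
    have U': "?U' \<in> carrier_mat n n" and V': "?V' \<in> carrier_mat n n"
      using U V by (auto intro: mat_adjoint_carrier)
    have D: "?D f \<in> carrier_mat n n" for f by simp
    note as = assoc_mult_mat[of _ n n _ n _ n]
    note cl = mult_carrier_mat[of _ n n _ n]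
    have "?V' * U * ?D d = ?V' * (U * ?D d * (?U' * U))"
      using U U' V' D by (simp add: UU as cl right_mult_one_mat[of _ n n])
    also have "\<dots> = ?V' * (X * U)" unfolding XU using U U' V' D by (simp add: as cl)
    also have "\<dots> = (?V' * V) * (?D e * (?V' * U))"
      unfolding XV using U V V' D by (simp add: as cl)
    also have "\<dots> = ?D e * (?V' * U)" using U V' D by (simp add: VV cl left_mult_one_mat[of _ n n])
    finally have "?V' * U * ?D (\<lambda>i. g (d i)) = ?D (\<lambda>i. g (e i)) * (?V' * U)"
      by (rule mat_diag_intertwine[OF cl[OF V' U]])
    then have "V * (?V' * U * ?D (\<lambda>i. g (d i))) * ?U' = V * (?D (\<lambda>i. g (e i)) * (?V' * U)) * ?U'"
      by simp
    moreover have "V * (?V' * U * ?D (\<lambda>i. g (d i))) * ?U' = (V * ?V') * (U * ?D (\<lambda>i. g (d i)) * ?U')"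
      using U U' V V' D by (simp add: as cl)
    moreover have "V * (?D (\<lambda>i. g (e i)) * (?V' * U)) * ?U' = V * ?D (\<lambda>i. g (e i)) * ?V' * (U * ?U')"
      using U U' V V' D by (simp add: as cl)
    ultimately show ?thesis
      using U U' V V' D by (simp add: UU VV cl left_mult_one_mat[of _ n n] right_mult_one_mat[of _ n n])
  qed
  show ?thesis
    unfolding fun_mat_def n
    by (rule the_equality) (use dec uniq in blast)+
qed

end

(*
  With B <= 15, g the identity on [0, 15] and g(A) - A = 2 (A - 15)_+ a positive rank-one matrix,
  passing from A - B to g(A) - g(B) adds this positive matrix.  Here the operator norm of A - B is
  attained at its negative eigenvalue, so the perturbation decreases the norm, while g does not
  change |A - B|, whose spectrum lies below the kink.  Concretely
    A = [[8, 8], [8, 8]] (eigenvalues 16, 0),  B = diag(15, 3),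
    A - B = [[-7, 8], [8, 5]] (eigenvalues -11, 9),  g(A) - g(B) = [[-6, 9], [9, 6]],
  and the last matrix squares to 117 I, with sqrt 117 < 11.
*)

theory Submission
  imports Defs
begin

section \<open>Adjoints and the inner product\<close>

lemma mat_adjoint_index:
  "i < dim_col A \<Longrightarrow> j < dim_row A \<Longrightarrow> mat_adjoint A $$ (i, j) = cnj (A $$ (j, i))"
  by (simp add: mat_adjoint_def mat_of_rows_def)

lemma mat_adjoint_adjoint:
  fixes A :: "complex mat"
  assumes "A \<in> carrier_mat n m"
  shows "mat_adjoint (mat_adjoint A) = A"
proof (rule eq_matI)
  have A': "mat_adjoint A \<in> carrier_mat m n"
    using assms by (rule mat_adjoint_carrier)
  show "dim_row (mat_adjoint (mat_adjoint A)) = dim_row A"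
    "dim_col (mat_adjoint (mat_adjoint A)) = dim_col A"
    using mat_adjoint_carrier[OF A'] assms by auto
  show "mat_adjoint (mat_adjoint A) $$ (i, j) = A $$ (i, j)" if "i < dim_row A" "j < dim_col A" for i j
    using that A' assms by (simp add: mat_adjoint_index)
qed

text \<open>Expanding the sesquilinear form over entries turns linearity in \<open>X\<close>, the
  boundedness of the form and the adjoint identity into computations with finite sums.\<close>

lemma cscalar_prod_mat_vec_sum:
  fixes X :: "complex mat"
  assumes "X \<in> carrier_mat n m" "v \<in> carrier_vec m" "u \<in> carrier_vec n"
  shows "(X *\<^sub>v v) \<bullet>c u = (\<Sum>i<n. \<Sum>j<m. X $$ (i, j) * v $ j * cnj (u $ i))"
  using assms by (auto simp: scalar_prod_def sum_distrib_right lessThan_atLeast0 intro!: sum.cong)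

lemma mat_adjoint_cscalar_prod:
  fixes X :: "complex mat"
  assumes X: "X \<in> carrier_mat n m" and v: "v \<in> carrier_vec m" and u: "u \<in> carrier_vec n"
  shows "(X *\<^sub>v v) \<bullet>c u = v \<bullet>c (mat_adjoint X *\<^sub>v u)"
proof -
  have X': "mat_adjoint X \<in> carrier_mat m n" using X by (rule mat_adjoint_carrier)
  have "v \<bullet>c (mat_adjoint X *\<^sub>v u) = (\<Sum>j<m. \<Sum>i<n. X $$ (i, j) * v $ j * cnj (u $ i))"
    using X X' v u
    by (auto simp: scalar_prod_def sum_distrib_left lessThan_atLeast0 mat_adjoint_index intro!: sum.cong)
  also have "\<dots> = (X *\<^sub>v v) \<bullet>c u"
    unfolding cscalar_prod_mat_vec_sum[OF assms] by (rule sum.swap)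
  finally show ?thesis by simp
qed

section \<open>Unit vectors and the operator norm\<close>

definition unit_vecs :: "nat \<Rightarrow> complex vec set" where
  "unit_vecs n = {v \<in> carrier_vec n. v \<bullet>c v = 1}"

lemma cscalar_prod_self:
  "v \<in> carrier_vec n \<Longrightarrow> v \<bullet>c v = complex_of_real (\<Sum>i<n. (cmod (v $ i))\<^sup>2)"
  by (auto simp: scalar_prod_def lessThan_atLeast0 complex_norm_square[symmetric] intro!: sum.cong)

lemma unit_vecs_iff: "v \<in> unit_vecs n \<longleftrightarrow> v \<in> carrier_vec n \<and> (\<Sum>i<n. (cmod (v $ i))\<^sup>2) = 1"
  using cscalar_prod_self[of v n] by (auto simp: unit_vecs_def simp del: of_real_sum)

lemma unit_vec_in_unit_vecs: "i < n \<Longrightarrow> unit_vec n i \<in> unit_vecs n"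
  by (auto simp: unit_vecs_iff if_distrib[of cmod] if_distrib[of "\<lambda>x. x\<^sup>2"] cong: if_cong)

lemma unit_vecs_norm_le_1:
  assumes "v \<in> unit_vecs n" "i < n"
  shows "cmod (v $ i) \<le> 1"
proof -
  have "(cmod (v $ i))\<^sup>2 \<le> (\<Sum>i<n. (cmod (v $ i))\<^sup>2)"
    using assms(2) by (intro member_le_sum) auto
  then show ?thesis using assms(1) by (simp add: unit_vecs_iff abs_square_le_1)
qed

lemma unitary_mat_adjoint: "unitary_mat n U \<Longrightarrow> unitary_mat n (mat_adjoint U)"
  by (auto simp: unitary_mat_def mat_adjoint_adjoint mat_adjoint_carrier)

lemma unitary_mat_unit_vecs:
  assumes U: "unitary_mat n U" and v: "v \<in> unit_vecs n"
  shows "U *\<^sub>v v \<in> unit_vecs n"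
proof -
  have Uc: "U \<in> carrier_mat n n" "mat_adjoint U \<in> carrier_mat n n" and UU: "mat_adjoint U * U = 1\<^sub>m n"
    using U by (auto simp: unitary_mat_def mat_adjoint_carrier)
  have vc: "v \<in> carrier_vec n" using v by (simp add: unit_vecs_def)
  have "(U *\<^sub>v v) \<bullet>c (U *\<^sub>v v) = v \<bullet>c ((mat_adjoint U * U) *\<^sub>v v)"
    using Uc vc by (simp add: mat_adjoint_cscalar_prod[of U n n])
  then show ?thesis using UU v Uc vc by (simp add: unit_vecs_def)
qed

text \<open>The largest singular value for \<open>0 < n\<close>, taken as a supremum of the
  sesquilinear form: the form is linear in \<open>X\<close>, and unitary factors can be moved onto
  \<open>v\<close> and \<open>u\<close>. For \<open>n = 0\<close> there are no unit vectors and the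
  supremum is over the empty set.\<close>

definition op_norm :: "nat \<Rightarrow> complex mat \<Rightarrow> real" where
  "op_norm n X = (SUP (v, u) \<in> unit_vecs n \<times> unit_vecs n. cmod ((X *\<^sub>v v) \<bullet>c u))"

lemma op_norm_upper:
  assumes X: "X \<in> carrier_mat n n" and vu: "v \<in> unit_vecs n" "u \<in> unit_vecs n"
  shows "cmod ((X *\<^sub>v v) \<bullet>c u) \<le> op_norm n X"
proof -
  \<comment> \<open>A crude bound independent of \<open>v\<close> and \<open>u\<close> suffices to
    make the real supremum an upper bound; coordinates of unit vectors have modulus at most
    1.\<close>
  have "cmod ((X *\<^sub>v v) \<bullet>c u) \<le> (\<Sum>i<n. \<Sum>j<n. cmod (X $$ (i, j)))"
    if "v \<in> unit_vecs n" "u \<in> unit_vecs n" for v u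
  proof -
    have "cmod ((X *\<^sub>v v) \<bullet>c u) = cmod (\<Sum>i<n. \<Sum>j<n. X $$ (i, j) * v $ j * cnj (u $ i))"
      using X that by (subst cscalar_prod_mat_vec_sum) (auto simp: unit_vecs_def)
    also have "\<dots> \<le> (\<Sum>i<n. \<Sum>j<n. cmod (X $$ (i, j)))"
    proof (intro sum_norm_le)
      fix i j assume "i \<in> {..<n}" "j \<in> {..<n}"
      then have "cmod (v $ j) * cmod (u $ i) \<le> 1"
        using that by (intro mult_le_one unit_vecs_norm_le_1) auto
      then show "cmod (X $$ (i, j) * v $ j * cnj (u $ i)) \<le> cmod (X $$ (i, j))"
        by (simp add: norm_mult mult.assoc mult_left_le)
    qed
    finally show ?thesis .
  qed
  then have "bdd_above ((\<lambda>(v, u). cmod ((X *\<^sub>v v) \<bullet>c u)) ` (unit_vecs n \<times> unit_vecs n))"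
    by (intro bdd_aboveI2) auto
  from cSUP_upper[OF _ this, of "(v, u)"] vu show ?thesis
    by (simp add: op_norm_def)
qed

lemma op_norm_least:
  assumes "0 < n"
    and "\<And>v u. v \<in> unit_vecs n \<Longrightarrow> u \<in> unit_vecs n \<Longrightarrow> cmod ((X *\<^sub>v v) \<bullet>c u) \<le> c"
  shows "op_norm n X \<le> c"
  unfolding op_norm_def
  using unit_vec_in_unit_vecs[OF assms(1)] assms(2) by (intro cSUP_least) auto

text \<open>The form at two standard basis vectors is an entry. This gives definiteness of the norm
  and, later, the lower bound 11.\<close>

lemma op_norm_ge_entry:
  assumes X: "X \<in> carrier_mat n n" and ij: "i < n" "j < n"
  shows "cmod (X $$ (i, j)) \<le> op_norm n X"
proof -
  \<comment> \<open>The condition on the outer index leaves the inner sum, so that both sums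
    collapse to one term.\<close>
  have *: "(\<Sum>j'<n. if i' = i then f j' else 0) = (if i' = i then \<Sum>j'<n. f j' else 0)"
    for i' and f :: "nat \<Rightarrow> complex" by simp
  have "(X *\<^sub>v unit_vec n j) \<bullet>c unit_vec n i = X $$ (i, j)"
    using X ij by (subst cscalar_prod_mat_vec_sum[OF X])
      (auto simp: * if_distrib[of cnj] if_distrib[of "\<lambda>x. _ * x"] cong: if_cong)
  then show ?thesis
    using op_norm_upper[OF X, of "unit_vec n j" "unit_vec n i"] ij by (simp add: unit_vec_in_unit_vecs)
qed

lemma op_norm_nonneg:
  assumes "0 < n" "X \<in> carrier_mat n n"
  shows "0 \<le> op_norm n X"
  using op_norm_ge_entry[OF assms(2,1,1)] norm_ge_zero order_trans by blast

lemma op_norm_smult_le: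
  assumes "0 < n" "X \<in> carrier_mat n n"
  shows "op_norm n (c \<cdot>\<^sub>m X) \<le> cmod c * op_norm n X"
proof (rule op_norm_least[OF assms(1)])
  fix v u assume vu: "v \<in> unit_vecs n" "u \<in> unit_vecs n"
  then have "(c \<cdot>\<^sub>m X *\<^sub>v v) \<bullet>c u = c * ((X *\<^sub>v v) \<bullet>c u)"
    using assms(2) by (simp add: cscalar_prod_mat_vec_sum[of _ n n] unit_vecs_def sum_distrib_left mult.assoc)
  then show "cmod ((c \<cdot>\<^sub>m X *\<^sub>v v) \<bullet>c u) \<le> cmod c * op_norm n X"
    using op_norm_upper[OF assms(2) vu] by (simp add: norm_mult mult_left_mono)
qed

text \<open>The form of \<open>U * X * V\<close> at \<open>v\<close>, \<open>u\<close> is the form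
  of \<open>X\<close> at \<open>V *\<^sub>v v\<close> and \<open>mat_adjoint U *\<^sub>v u\<close>,
  which are again unit vectors.\<close>

lemma op_norm_unitary_le:
  assumes "0 < n" and X: "X \<in> carrier_mat n n" and U: "unitary_mat n U" and V: "unitary_mat n V"
  shows "op_norm n (U * X * V) \<le> op_norm n X"
proof (rule op_norm_least[OF assms(1)])
  fix v u assume vu: "v \<in> unit_vecs n" "u \<in> unit_vecs n"
  have c: "U \<in> carrier_mat n n" "V \<in> carrier_mat n n" "v \<in> carrier_vec n" "u \<in> carrier_vec n"
    using U V vu by (auto simp: unitary_mat_def unit_vecs_def)
  have "(U * X * V *\<^sub>v v) \<bullet>c u = (U *\<^sub>v (X *\<^sub>v (V *\<^sub>v v))) \<bullet>c u"
    using c X by (simp add: assoc_mult_mat_vec[of _ n n _ n] mult_carrier_mat[of _ n n _ n])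
  also have "\<dots> = (X *\<^sub>v (V *\<^sub>v v)) \<bullet>c (mat_adjoint U *\<^sub>v u)"
    using c X by (intro mat_adjoint_cscalar_prod) auto
  finally show "cmod ((U * X * V *\<^sub>v v) \<bullet>c u) \<le> op_norm n X"
    using op_norm_upper[OF X] vu U V by (simp add: unitary_mat_adjoint unitary_mat_unit_vecs)
qed

lemma op_norm_unitarily_invariant:
  assumes n: "0 < n"
  shows "unitarily_invariant_norm n (op_norm n)"
  unfolding unitarily_invariant_norm_def mat_norm_def
proof (intro conjI ballI allI impI)
  fix X :: "complex mat" assume X: "X \<in> carrier_mat n n"
  show "0 \<le> op_norm n X" by (rule op_norm_nonneg[OF n X])
  show "op_norm n X = 0 \<longleftrightarrow> X = 0\<^sub>m n n"
  proof
    assume "op_norm n X = 0"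
    then have "X $$ (i, j) = 0" if "i < n" "j < n" for i j
      using op_norm_ge_entry[OF X that] by simp
    then show "X = 0\<^sub>m n n" using X by (intro eq_matI) auto
  next
    assume "X = 0\<^sub>m n n"
    then have "op_norm n X \<le> 0"
      by (intro op_norm_least[OF n]) (auto simp: cscalar_prod_mat_vec_sum[of _ n n] unit_vecs_def)
    then show "op_norm n X = 0" using op_norm_nonneg[OF n X] by simp
  qed
  show "op_norm n (c \<cdot>\<^sub>m X) = cmod c * op_norm n X" for c
  proof (rule antisym[OF op_norm_smult_le[OF n X]])
    show "cmod c * op_norm n X \<le> op_norm n (c \<cdot>\<^sub>m X)"
    proof (cases "c = 0")
      case True
      then show ?thesis using op_norm_nonneg[OF n] X by simp
    next
      case False
      \<comment> \<open>The reverse inequality is the one-sided bound for the scalar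
        \<open>inverse c\<close> and the matrix \<open>c \<cdot>\<^sub>m X\<close>.\<close>
      have "inverse c \<cdot>\<^sub>m (c \<cdot>\<^sub>m X) = X"
        using X False by (intro eq_matI) auto
      then have "op_norm n X \<le> cmod (inverse c) * op_norm n (c \<cdot>\<^sub>m X)"
        using op_norm_smult_le[OF n, of "c \<cdot>\<^sub>m X" "inverse c"] X by simp
      then show ?thesis using False by (simp add: norm_inverse norm_divide field_simps)
    qed
  qed
  show "op_norm n (X + Y) \<le> op_norm n X + op_norm n Y" if Y: "Y \<in> carrier_mat n n" for Y
  proof (rule op_norm_least[OF n])
    fix v u assume vu: "v \<in> unit_vecs n" "u \<in> unit_vecs n"
    have "((X + Y) *\<^sub>v v) \<bullet>c u = (X *\<^sub>v v) \<bullet>c u + (Y *\<^sub>v v) \<bullet>c u"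
      using vu X Y by (simp add: cscalar_prod_mat_vec_sum[of _ n n] unit_vecs_def distrib_right sum.distrib)
    then show "cmod (((X + Y) *\<^sub>v v) \<bullet>c u) \<le> op_norm n X + op_norm n Y"
      using op_norm_upper[OF X vu] op_norm_upper[OF Y vu] by (simp add: norm_triangle_le)
  qed
  show "op_norm n (U * X * V) = op_norm n X" if U: "unitary_mat n U" and V: "unitary_mat n V" for U V
  proof (rule antisym[OF op_norm_unitary_le[OF n X U V]])
    have c: "U \<in> carrier_mat n n" "V \<in> carrier_mat n n"
      and c': "mat_adjoint U \<in> carrier_mat n n" "mat_adjoint V \<in> carrier_mat n n"
      and e: "mat_adjoint U * U = 1\<^sub>m n" "V * mat_adjoint V = 1\<^sub>m n"
      using U V by (auto simp: unitary_mat_def mat_adjoint_carrier)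
    \<comment> \<open>Likewise, the reverse inequality is the one-sided bound for the adjoint
      unitaries, which undo \<open>U\<close> and \<open>V\<close>.\<close>
    have "mat_adjoint U * (U * X * V) * mat_adjoint V = (mat_adjoint U * U) * X * (V * mat_adjoint V)"
      using c c' X by (simp add: assoc_mult_mat[of _ n n _ n _ n] mult_carrier_mat[of _ n n _ n])
    also have "\<dots> = X" using e X by simp
    finally show "op_norm n X \<le> op_norm n (U * X * V)"
      using op_norm_unitary_le[OF n, of "U * X * V" "mat_adjoint U" "mat_adjoint V"] U V X c
      by (simp add: unitary_mat_adjoint mult_carrier_mat[of _ n n _ n])
  qed
qed

text \<open>\<open>W\<close> maps unit vectors to unit vectors. Cauchy-Schwarz for two unit vectors
  \<open>w\<close>, \<open>u\<close> follows termwise from the inequality of arithmetic and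
  geometric means, and the two halves add up to 1.\<close>

lemma op_norm_unitary_le_1:
  assumes n: "0 < n" and W: "unitary_mat n W"
  shows "op_norm n W \<le> 1"
proof (rule op_norm_least[OF n])
  fix v u assume "v \<in> unit_vecs n" and u: "u \<in> unit_vecs n"
  define w where "w = W *\<^sub>v v"
  have w: "w \<in> unit_vecs n"
    unfolding w_def using W \<open>v \<in> unit_vecs n\<close> by (rule unitary_mat_unit_vecs)
  have "cmod (w \<bullet>c u) = cmod (\<Sum>i<n. w $ i * cnj (u $ i))"
    using w u by (auto simp: scalar_prod_def lessThan_atLeast0 unit_vecs_def)
  also have "\<dots> \<le> (\<Sum>i<n. ((cmod (w $ i))\<^sup>2 + (cmod (u $ i))\<^sup>2) / 2)"
  proof (rule sum_norm_le)
    fix i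
    show "cmod (w $ i * cnj (u $ i)) \<le> ((cmod (w $ i))\<^sup>2 + (cmod (u $ i))\<^sup>2) / 2"
      using sum_squares_bound[of "cmod (w $ i)" "cmod (u $ i)"] by (simp add: norm_mult)
  qed
  also have "\<dots> = 1"
    using w u by (simp add: unit_vecs_iff sum.distrib flip: sum_divide_distrib)
  finally show "cmod ((W *\<^sub>v v) \<bullet>c u) \<le> 1" by (simp add: w_def)
qed

text \<open>The quadratic form at \<open>v\<close> is the squared length of
  \<open>M *\<^sub>v v\<close>. Positivity of the two witnesses is certified by exhibiting such a
  factor \<open>M\<close>.\<close>

lemma psd_mat_gram:
  assumes M: "M \<in> carrier_mat n n"
  shows "psd_mat n (mat_adjoint M * M)"
proof -
  have M': "mat_adjoint M \<in> carrier_mat n n" using M by (rule mat_adjoint_carrier)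
  have MM: "mat_adjoint M * M \<in> carrier_mat n n" using M M' by simp
  have "mat_adjoint (mat_adjoint M * M) = mat_adjoint M * M"
    using M M' MM mat_adjoint_carrier[OF MM]
    by (intro eq_matI) (auto simp: mat_adjoint_index scalar_prod_def mult.commute)
  moreover have "0 \<le> Re ((mat_adjoint M * M *\<^sub>v v) \<bullet>c v)" if v: "v \<in> carrier_vec n" for v
  proof -
    have Mv: "M *\<^sub>v v \<in> carrier_vec n" using M v by simp
    have "(mat_adjoint M * M *\<^sub>v v) \<bullet>c v = (mat_adjoint M *\<^sub>v (M *\<^sub>v v)) \<bullet>c v"
      using M M' v by simp
    also have "\<dots> = (M *\<^sub>v v) \<bullet>c (M *\<^sub>v v)"
      using mat_adjoint_cscalar_prod[OF M' Mv v] by (simp add: mat_adjoint_adjoint[OF M])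
    finally show ?thesis by (simp add: cscalar_prod_self[OF Mv] sum_nonneg del: of_real_sum)
  qed
  ultimately show ?thesis using MM by (simp add: psd_mat_def)
qed

section \<open>Explicit two-by-two matrices and their functional calculus\<close>

definition mat2 :: "complex \<Rightarrow> complex \<Rightarrow> complex \<Rightarrow> complex \<Rightarrow> complex mat" where
  "mat2 a b c d = mat 2 2 (\<lambda>(i, j). if i = 0 then if j = 0 then a else b else if j = 0 then c else d)"

lemma mat2_carrier [simp]: "mat2 a b c d \<in> carrier_mat 2 2"
  by (simp add: mat2_def)

lemma mat2_index [simp]:
  "mat2 a b c d $$ (0, 0) = a" "mat2 a b c d $$ (0, Suc 0) = b"
  "mat2 a b c d $$ (Suc 0, 0) = c" "mat2 a b c d $$ (Suc 0, Suc 0) = d"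
  by (auto simp: mat2_def)

lemma mat2_dim [simp]: "dim_row (mat2 a b c d) = 2" "dim_col (mat2 a b c d) = 2"
  by (auto simp: mat2_def)

lemma mat2_mult: "mat2 a b c d * mat2 a' b' c' d' =
    mat2 (a * a' + b * c') (a * b' + b * d') (c * a' + d * c') (c * b' + d * d')"
  by (rule eq_matI) (auto simp: scalar_prod_def less_2_cases_iff eval_nat_numeral(2) sum.atLeast0_lessThan_Suc less_Suc_eq)

lemma mat2_minus: "mat2 a b c d - mat2 a' b' c' d' = mat2 (a - a') (b - b') (c - c') (d - d')"
  by (rule eq_matI) (auto simp: less_2_cases_iff)

lemma mat2_adjoint: "mat_adjoint (mat2 a b c d) = mat2 (cnj a) (cnj c) (cnj b) (cnj d)"
  using mat_adjoint_carrier[of "mat2 a b c d" 2 2]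
  by (intro eq_matI) (auto simp: less_2_cases_iff mat_adjoint_index)

lemma mat2_diag: "mat_diag 2 f = mat2 (f 0) 0 0 (f 1)"
  by (rule eq_matI) (auto simp: mat_diag_def less_2_cases_iff)

lemma mat2_one: "1\<^sub>m 2 = mat2 1 0 0 1"
  by (rule eq_matI) (auto simp: less_2_cases_iff)

lemma mat2_smult: "k \<cdot>\<^sub>m mat2 a b c d = mat2 (k * a) (k * b) (k * c) (k * d)"
  by (rule eq_matI) (auto simp: less_2_cases_iff)

text \<open>With these rules an identity between concrete matrices becomes four scalar
  identities.\<close>

lemmas mat2_simps = mat2_mult mat2_minus mat2_adjoint mat2_diag mat2_one mat2_smult

lemma fun_mat_unitary_diag:
  assumes U: "unitary_mat n U"
  shows "fun_mat g (U * mat_diag n (\<lambda>i. complex_of_real (d i)) * mat_adjoint U)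
       = U * mat_diag n (\<lambda>i. complex_of_real (g (d i))) * mat_adjoint U"
proof (rule fun_mat_eq)
  show "U * mat_diag n (\<lambda>i. complex_of_real (d i)) * mat_adjoint U \<in> carrier_mat n n"
    using U by (auto simp: unitary_mat_def intro!: mult_carrier_mat[of _ n n _ n] mat_adjoint_carrier)
qed (use U in \<open>simp add: spectral_decomp_def\<close>)

section \<open>The counterexample\<close>

theorem mainTheorem6:
  shows "\<exists>(n::nat) (A::complex mat) (B::complex mat) (N::complex mat \<Rightarrow> real) (g::real \<Rightarrow> real).
           psd_mat n A \<and> psd_mat n B \<and> unitarily_invariant_norm n N
         \<and> (\<forall>t\<ge>0. 0 \<le> g t) \<and> mono_on {0..} g \<and> convex_on {0..} g \<and> g 0 = 0
         \<and> N (fun_mat g A - fun_mat g B) < N (fun_mat g (abs_mat (A - B)))"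
proof (intro exI conjI)
  define A B where "A = mat2 8 8 8 8" and "B = mat2 15 0 0 3"
  \<comment> \<open>The two lines cross at 15, the top eigenvalue of \<open>B\<close>. So
    \<open>g\<close> fixes 0, 3, 9, 11 and 15, and sends 16 to 18.\<close>
  define g :: "real \<Rightarrow> real" where "g t = max t (3 * t - 30)" for t
  show "\<forall>t\<ge>0. 0 \<le> g t" "mono_on {0..} g" "g 0 = 0"
    by (auto simp: g_def mono_on_def)
  show "convex_on {0..} g"
    unfolding convex_on_def
  proof (intro conjI ballI allI impI)
    fix x y u v :: real assume "0 \<le> u" "0 \<le> v" and uv: "u + v = 1"
    \<comment> \<open>A maximum of two affine functions is convex: each of them at the convex
      combination lies below the combination of the values of \<open>g\<close>.\<close>
    then have "u * x + v * y \<le> u * g x + v * g y"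
      "u * (3 * x - 30) + v * (3 * y - 30) \<le> u * g x + v * g y"
      by (auto simp: g_def intro!: add_mono mult_left_mono)
    \<comment> \<open>The constant 30 splits because the weights sum to 1; the unfolding replaces
      \<open>u\<close> by \<open>1 - v\<close>.\<close>
    moreover have "3 * (u * x + v * y) - 30 = u * (3 * x - 30) + v * (3 * y - 30)"
      unfolding eq_diff_eq[THEN iffD2, OF uv] by (simp add: algebra_simps)
    ultimately show "g (u *\<^sub>R x + v *\<^sub>R y) \<le> u * g x + v * g y"
      by (simp add: g_def)
  qed simp
  have "A = mat_adjoint (mat2 2 2 2 2) * mat2 2 2 2 2"
    by (simp add: A_def mat2_simps)
  then show "psd_mat 2 A" by (simp add: psd_mat_gram)
  have sq: "complex_of_real (sqrt x) * complex_of_real (sqrt x) = of_real x" if "0 \<le> x" for x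
    using that by (simp flip: of_real_mult)
  have "B = mat_adjoint (mat2 (sqrt 15) 0 0 (sqrt 3)) * mat2 (sqrt 15) 0 0 (sqrt 3)"
    by (simp add: B_def mat2_simps sq)
  then show "psd_mat 2 B" by (simp add: psd_mat_gram)
  show uin: "unitarily_invariant_norm 2 (op_norm 2)"
    by (simp add: op_norm_unitarily_invariant)

  \<comment> \<open>For \<open>a * a + b * b = 1\<close> this is the rotation with cosine
    \<open>a\<close> and sine \<open>b\<close>. Below, \<open>?S a b x y\<close> is the real
    symmetric matrix with eigenvalue \<open>x\<close> on \<open>(a, b)\<close> and \<open>y\<close>
    on \<open>(-b, a)\<close>, so a function acts on it through \<open>x\<close> and
    \<open>y\<close> alone.\<close>
  define R where "R a b = mat2 (complex_of_real a) (- complex_of_real b) (complex_of_real b) (complex_of_real a)" for a b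
  have R_unitary: "unitary_mat 2 (R a b)" if "a * a + b * b = 1" for a b
  proof -
    have "complex_of_real a * complex_of_real a + complex_of_real b * complex_of_real b = 1"
      "complex_of_real b * complex_of_real b + complex_of_real a * complex_of_real a = 1"
      using that by (simp_all add: add.commute flip: of_real_mult of_real_add)
    then show ?thesis by (simp add: unitary_mat_def R_def mat2_simps mult.commute)
  qed
  let ?S = "\<lambda>a b x y. mat2 (complex_of_real (a * a * x + b * b * y)) (complex_of_real (a * b * (x - y)))
      (complex_of_real (a * b * (x - y))) (complex_of_real (b * b * x + a * a * y))"
  have R_diag: "R a b * mat_diag 2 (\<lambda>i. complex_of_real (d i)) * mat_adjoint (R a b) = ?S a b (d 0) (d 1)"
    for a b d
    by (simp add: R_def mat2_simps algebra_simps)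
  have R_fun: "fun_mat f (?S a b x y) = ?S a b (f x) (f y)" if "a * a + b * b = 1" for a b x y f
    using fun_mat_unitary_diag[OF R_unitary[OF that], of f "\<lambda>i. if i = 0 then x else y"]
    unfolding R_diag by simp

  \<comment> \<open>\<open>A\<close> has eigenvalue 16 on the diagonal direction and 0 on its
    orthogonal complement; \<open>g\<close> turns 16 into 18.\<close>
  have "fun_mat g A = mat2 9 9 9 9"
    using R_fun[of "1 / sqrt 2" "1 / sqrt 2" g 16 0] by (simp add: A_def g_def)
  moreover have "fun_mat g B = B"
    using R_fun[of 1 0 g 15 3] by (simp add: B_def g_def)
  ultimately have GAB: "fun_mat g A - fun_mat g B = mat2 (-6) 9 9 6"
    by (simp add: B_def mat2_simps)
  \<comment> \<open>The difference is Hermitian with square 117 times the identity, hence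
    \<open>sqrt 117\<close> times a unitary \<open>W\<close>; its norm is therefore at most
    \<open>sqrt 117\<close>.\<close>
  define c where "c = complex_of_real (sqrt 117)"
  define W where "W = mat2 (-6 / c) (9 / c) (9 / c) (6 / c)"
  have c: "c * c = 117" "c \<noteq> 0" "cnj c = c" "cmod c = sqrt 117"
    using sq[of 117] by (auto simp: c_def)
  have "unitary_mat 2 W"
    using c by (simp add: unitary_mat_def W_def mat2_simps)
  moreover have "fun_mat g A - fun_mat g B = c \<cdot>\<^sub>m W"
    using c by (simp add: GAB W_def mat2_simps)
  ultimately have "op_norm 2 (fun_mat g A - fun_mat g B) \<le> sqrt 117 * op_norm 2 W" "op_norm 2 W \<le> 1"
    using op_norm_smult_le[of 2 W c] op_norm_unitary_le_1[of 2 W] c by (simp_all add: unitary_mat_def)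
  then have "op_norm 2 (fun_mat g A - fun_mat g B) \<le> sqrt 117"
    by (elim order_trans) (simp add: mult_left_le)
  also have "sqrt 117 < 11"
    by (rule real_less_lsqrt) auto
  also have "11 \<le> op_norm 2 (fun_mat g (abs_mat (A - B)))"
  proof -
    \<comment> \<open>\<open>(2, -1)\<close> is an eigenvector of \<open>A - B\<close> for -11, and
      \<open>(1, 2)\<close> for 9; dividing by \<open>sqrt 5\<close> normalizes them. The square
      thus has eigenvalues 121 and 81, whose roots are 11 and 9.\<close>
    define a b where "a = 2 / sqrt 5" and "b = - 1 / sqrt 5"
    have ab: "a * a = 4/5" "b * b = 1/5" "a * b = - 2/5" "a * a + b * b = 1"
      by (auto simp: a_def b_def)
    let ?U = "R a b" and ?D = "mat_diag 2 (\<lambda>i. complex_of_real (if i = 0 then 11 else 9))"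
    have U: "unitary_mat 2 ?U" by (rule R_unitary[OF ab(4)])
    have "mat_adjoint (A - B) * (A - B) = ?S a b 121 81"
      unfolding ab by (simp add: A_def B_def mat2_simps)
    then have "abs_mat (A - B) = ?S a b (sqrt 121) (sqrt 81)"
      unfolding abs_mat_def by (simp only: R_fun[OF ab(4)])
    also have "\<dots> = ?S a b 11 9"
      by (simp add: real_sqrt_eq_iff real_sqrt_unique)
    finally have "fun_mat g (abs_mat (A - B)) = ?S a b (g 11) (g 9)"
      by (simp only: R_fun[OF ab(4)])
    \<comment> \<open>Both 11 and 9 are below the kink at 15, so \<open>g\<close> fixes them.
      Unitary invariance then reduces the norm to that of \<open>?D\<close>, which has 11 as an
      entry.\<close>
    also have "\<dots> = ?U * ?D * mat_adjoint ?U"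
      by (simp add: R_diag g_def)
    finally have "op_norm 2 (fun_mat g (abs_mat (A - B))) = op_norm 2 ?D"
      using uin U by (simp add: unitarily_invariant_norm_def unitary_mat_adjoint)
    moreover have "11 \<le> op_norm 2 ?D"
      using op_norm_ge_entry[of ?D 2 0 0] by (simp add: mat_diag_def)
    ultimately show ?thesis by simp
  qed
  finally show "op_norm 2 (fun_mat g A - fun_mat g B) < op_norm 2 (fun_mat g (abs_mat (A - B)))" .
qed

end
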